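(* Let $K$ be a field of characteristic zero with algebraic closure $\bar K$, and let $\phi(z) = -\frac{z^2+2z}{2z+3} \in K(z)$. The following statements are equivalent: (1) Every cubic rational function $f \in \bar K(z)$ all of whose critical points lie in $\mathbb{P}^1(K)$ is equivalent to a rational function in $K(z)$. (2) $K$ is $\phi$-perfect.
   Context: Two rational functions $f,g \in \bar K(z)$ are called equivalent if there is a fractional linear transformation $\sigma \in \bar K(z)$ (a degree-one rational function) such that $f = \sigma \circ g$. For a field $K$ and a nonconstant rational function $\phi \in K(z)$, $K$ is called $\phi$-perfect if the induced map $\phi \colon \mathbb{P}^1(K) \to \mathbb{P}^1(K)$ is surjective. The critical points of a rational function are the points of $\mathbb{P}^1(\bar K)$ at which it is not locally injective (ramification points). *)

theory Defs
  imports "HOL-Algebra.Algebraic_Closure_Type"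
begin

section \<open>The projective line\<close>

datatype 'a p1 = Fin 'a | Infty

section \<open>Rational functions\<close>

text \<open>
  The field $K(z)$ is the fraction field \<open>'a poly fract\<close> of the polynomial ring.
  A numerator and denominator in lowest terms are unique up to a common nonzero
  scalar factor; none of the notions below depends on the choice of that factor.
\<close>

definition reduced_rep :: "'a::field poly fract \<Rightarrow> 'a poly \<times> 'a poly \<Rightarrow> bool" where
  "reduced_rep f pq \<longleftrightarrow> snd pq \<noteq> 0 \<and> coprime (fst pq) (snd pq) \<and> f = Fract (fst pq) (snd pq)"

definition rat_num :: "'a::field poly fract \<Rightarrow> 'a poly" where
  "rat_num f = fst (SOME pq. reduced_rep f pq)"

definition rat_den :: "'a::field poly fract \<Rightarrow> 'a poly" where
  "rat_den f = snd (SOME pq. reduced_rep f pq)"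

definition rat_degree :: "'a::field poly fract \<Rightarrow> nat" where
  "rat_degree f = max (Polynomial.degree (rat_num f)) (Polynomial.degree (rat_den f))"

fun rat_eval :: "'a::field poly fract \<Rightarrow> 'a p1 \<Rightarrow> 'a p1" where
  "rat_eval f (Fin x) =
     (if poly (rat_den f) x = 0 then Infty else Fin (poly (rat_num f) x / poly (rat_den f) x))"
| "rat_eval f Infty =
     (if Polynomial.degree (rat_num f) > Polynomial.degree (rat_den f) then Infty
      else Fin (Polynomial.coeff (rat_num f) (Polynomial.degree (rat_den f)) /
                Polynomial.lead_coeff (rat_den f)))"

text \<open>
  \<open>rat_comp f g\<close> is $f \circ g$: numerator and denominator of $f$ are evaluated at $g$
  in the field $K(z)$.  The denominator can only vanish if \<open>g\<close> is constant.
\<close>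

definition rat_comp :: "'a::field poly fract \<Rightarrow> 'a poly fract \<Rightarrow> 'a poly fract" where
  "rat_comp f g =
     poly (map_poly (\<lambda>c. to_fract [:c:]) (rat_num f)) g /
     poly (map_poly (\<lambda>c. to_fract [:c:]) (rat_den f)) g"

definition rat_equiv :: "'a::field poly fract \<Rightarrow> 'a poly fract \<Rightarrow> bool" where
  "rat_equiv f g \<longleftrightarrow> (\<exists>\<sigma>. rat_degree \<sigma> = 1 \<and> f = rat_comp \<sigma> g)"

text \<open>The inclusion of $K(z)$ into $\bar K(z)$.\<close>

definition rat_to_ac :: "'a::field poly fract \<Rightarrow> 'a alg_closure poly fract" where
  "rat_to_ac g = Fract (map_poly to_ac (rat_num g)) (map_poly to_ac (rat_den g))"

section \<open>Ramification\<close>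

text \<open>
  For $f = p/q$ in lowest terms, of degree $d$, the fibre of $f$ over $c$ is the zero
  scheme of the binary form of degree $d$ obtained by homogenizing $p - c q$
  (respectively $q$ if $c = \infty$).  The ramification index of $f$ at $x$ is the
  multiplicity of $x$ in the fibre over $f(x)$; at infinity, the form obtained from a
  polynomial $h$ vanishes to order $d - \deg h$.
\<close>

fun fibre_poly :: "'a::field poly fract \<Rightarrow> 'a p1 \<Rightarrow> 'a poly" where
  "fibre_poly f (Fin c) = rat_num f - Polynomial.smult c (rat_den f)"
| "fibre_poly f Infty = rat_den f"

fun ram_index :: "'a::field poly fract \<Rightarrow> 'a p1 \<Rightarrow> nat" where
  "ram_index f (Fin x) = Polynomial.order x (fibre_poly f (rat_eval f (Fin x)))"
| "ram_index f Infty = rat_degree f - Polynomial.degree (fibre_poly f (rat_eval f Infty))"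

definition critical_points :: "'a::field poly fract \<Rightarrow> 'a p1 set" where
  "critical_points f = {x. ram_index f x > 1}"

section \<open>Perfectness with respect to a rational function\<close>

definition perfect_wrt :: "'a::field poly fract \<Rightarrow> bool" where
  "perfect_wrt \<phi> \<longleftrightarrow> surj (rat_eval \<phi>)"

section \<open>Lowest terms\<close>

lemma reduced_rep_exists: "\<exists>pq. reduced_rep (f :: 'a::field poly fract) pq"
proof -
  define P where "P = (\<lambda>pq. snd pq \<noteq> 0 \<and> f = Fract (fst pq) (snd pq))"
  have "\<exists>pq. P pq"
    unfolding P_def by (cases f) auto
  then obtain pq where pq: "P pq"
    and min: "\<And>rs. P rs \<Longrightarrow> Polynomial.degree (snd pq) \<le> Polynomial.degree (snd rs)"
    using ex_has_least_nat[of P _ "\<lambda>pq. Polynomial.degree (snd pq)"] by blast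
  have "coprime (fst pq) (snd pq)"
  proof (rule coprimeI)
    fix c assume c: "c dvd fst pq" "c dvd snd pq"
    then obtain a b where ab: "fst pq = c * a" "snd pq = c * b"
      by (auto elim!: dvdE)
    have nz: "c \<noteq> 0" "b \<noteq> 0"
      using pq ab by (auto simp: P_def)
    have "P (a, b)"
      using pq nz unfolding P_def ab by (auto simp: eq_fract)
    from min[OF this] have "Polynomial.degree c = 0"
      using nz by (simp add: ab degree_mult_eq)
    with nz show "is_unit c"
      by (simp add: is_unit_iff_degree)
  qed
  with pq have "reduced_rep f pq"
    by (simp add: reduced_rep_def P_def)
  then show ?thesis ..
qed

lemma reduced_rep_num_den: "reduced_rep f (rat_num f, rat_den f)"
  unfolding rat_num_def rat_den_def using someI_ex[OF reduced_rep_exists[of f]] by simp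

lemma poly_coprime_dvd_cancel:
  fixes p q r :: "'a::field poly"
  assumes "coprime p q" "q \<noteq> 0" "q dvd p * r"
  shows "q dvd r"
proof -
  define I where "I = (\<lambda>h. h \<noteq> 0 \<and> (\<exists>a b. h = a * p + b * q))"
  have "I q"
    using assms(2) unfolding I_def by (metis add_0 mult_1 mult_zero_left)
  then obtain h where h: "I h" and min: "\<And>k. I k \<Longrightarrow> Polynomial.degree h \<le> Polynomial.degree k"
    using ex_has_least_nat[of I q Polynomial.degree] by blast
  then obtain a b where ab: "h = a * p + b * q" and "h \<noteq> 0"
    unfolding I_def by blast
  have dvd: "h dvd x * p + y * q" for x y
  proof (rule ccontr)
    define z where "z = x * p + y * q"
    assume "\<not> h dvd x * p + y * q"
    then have nz: "z mod h \<noteq> 0"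
      by (simp add: mod_eq_0_iff_dvd z_def)
    have "z mod h = z - z div h * h"
      by (simp add: minus_div_mult_eq_mod)
    also have "\<dots> = (x - z div h * a) * p + (y - z div h * b) * q"
      unfolding ab by (simp add: z_def algebra_simps)
    finally have "I (z mod h)"
      unfolding I_def using nz by blast
    from min[OF this] show False
      using degree_mod_less[of h z] \<open>h \<noteq> 0\<close> nz by simp
  qed
  have "h dvd p" "h dvd q"
    using dvd[of 1 0] dvd[of 0 1] by simp_all
  with assms(1) have "h dvd 1"
    by (rule coprime_common_divisor)
  then obtain u where "1 = h * u" by (elim dvdE)
  then have "r = u * a * (p * r) + u * b * r * q"
    unfolding ab by (metis (no_types, opaque_lifting) ab distrib_left distrib_right mult.assoc mult.commute mult_1)
  then show ?thesis
    using assms(3) by (metis dvd_add dvd_mult dvd_triv_right)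
qed

lemma reduced_rep_unique:
  fixes f :: "'a::field poly fract"
  assumes "reduced_rep f (p, q)"
  obtains c where "c \<noteq> 0" "rat_num f = Polynomial.smult c p" "rat_den f = Polynomial.smult c q"
proof -
  have A: "q \<noteq> 0" "coprime p q" "f = Fract p q"
    using assms by (auto simp: reduced_rep_def)
  have B: "rat_den f \<noteq> 0" "coprime (rat_num f) (rat_den f)" "f = Fract (rat_num f) (rat_den f)"
    using reduced_rep_num_den[of f] by (auto simp: reduced_rep_def)
  have "Fract (rat_num f) (rat_den f) = Fract p q"
    using A(3) B(3) by simp
  then have eq: "rat_num f * q = p * rat_den f"
    using A(1) B(1) by (simp add: eq_fract)
  have "q dvd rat_den f"
    using A(2,1) by (rule poly_coprime_dvd_cancel) (simp flip: eq)
  then obtain u where u: "rat_den f = q * u" by (elim dvdE)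
  have "rat_den f dvd q"
    using B(2,1) by (rule poly_coprime_dvd_cancel) (simp add: eq)
  then have "q * u dvd q * 1"
    using u by simp
  then have "u dvd 1"
    using A(1) by (subst (asm) dvd_mult_cancel_left) simp
  then obtain c where c: "u = [:c:]" "c \<noteq> 0"
    by (metis is_unit_poly_iff not_is_unit_0 pCons_0_0)
  have "rat_num f * q = p * u * q"
    using eq u by (simp add: ac_simps)
  then have "rat_num f = p * u"
    using A(1) by simp
  with u c that show ?thesis by (simp add: mult.commute)
qed

end

theory Submission
  imports Defs
begin

text \<open>
  The class of a cubic $f = p/q$ under postcomposition is the pencil spanned by $p$ and $q$
  in the space of polynomials of degree at most 3, and it contains a function over $K$ iff the
  Plucker coordinates of the pencil lie in $K$ up to a common factor. Five linear combinations
  of these six coordinates are the coefficients of the Wronskian $w$ of $p$ and $q$, a binary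
  quartic form whose zeros are the critical points. The Plucker relation is a quadratic equation
  for the remaining coordinate, with discriminant $w_2^2 - 3 w_1 w_3 + 12 w_0 w_4$. If $w$ is a
  product of four linear forms, this is $A^2 - AB + B^2$ for two products $A$, $B$ of
  $2 \times 2$ determinants, so condition (1) says that $c^2 - c + 1$ is a square for every
  $c$ in $K$. But $(1 + c)^2 - 3c = c^2 - c + 1$ is also a quarter of the discriminant of the
  quadratic equation $\phi(z) = c$.
\<close>

section \<open>Coprimality and extension of scalars\<close>

text \<open>Euclid's algorithm with back-substitution. Coprimality is turned into an identity
  because an identity survives passage to a larger field.\<close>

lemma coprime_poly_bezout:
  fixes p q :: "'a::field poly"
  assumes "coprime p q"
  obtains a b where "a * p + b * q = 1"
proof -
  have "\<exists>a b. a * p + b * q = 1"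
    using assms
  \<comment> \<open>The successor places the zero polynomial strictly below the nonzero constants,
    so a division with remainder 0 also decreases the measure.\<close>
  proof (induction "if q = 0 then 0 else Suc (Polynomial.degree q)" arbitrary: p q rule: less_induct)
    case less
    show ?case
    proof (cases "q = 0")
      case True
      then have "p dvd 1" using less.prems by simp
      then obtain u where "1 = p * u" by (elim dvdE)
      then show ?thesis using True by (intro exI[of _ u] exI[of _ 0]) (simp add: mult.commute)
    next
      case False
      have "coprime q (p mod q)"
      proof (rule coprimeI)
        fix c assume "c dvd q" "c dvd p mod q"
        then have "c dvd p" by (simp add: dvd_mod_iff)
        with \<open>c dvd q\<close> less.prems show "is_unit c"
          by (meson coprime_common_divisor)
      qed
      moreover have "(if p mod q = 0 then 0 else Suc (Polynomial.degree (p mod q)))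
          < (if q = 0 then 0 else Suc (Polynomial.degree q))"
        using False degree_mod_less[of q p] by auto
      ultimately obtain a b where "a * q + b * (p mod q) = 1"
        using less.hyps by blast
      then have "b * p + (a - b * (p div q)) * q = 1"
        by (simp add: minus_div_mult_eq_mod[symmetric] algebra_simps)
      then show ?thesis by blast
    qed
  qed
  with that show thesis by blast
qed

lemma bezout_imp_coprime:
  fixes p q :: "'a::algebraic_semidom"
  assumes "is_unit (a * p + b * q)"
  shows "coprime p q"
  by (rule coprimeI) (meson assms dvd_add dvd_mult dvd_trans)

lemma map_poly_to_ac_add:
  "map_poly to_ac (p + q) = map_poly to_ac p + map_poly to_ac q"
  by (rule poly_eqI) (simp add: coeff_map_poly)

lemma map_poly_to_ac_mult:
  "map_poly to_ac (p * q) = map_poly to_ac p * map_poly to_ac q"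
  by (rule poly_eqI) (simp add: coeff_map_poly coeff_mult to_ac_sum)

lemma map_poly_to_ac_eq_0_iff [simp]: "map_poly to_ac p = 0 \<longleftrightarrow> p = 0"
  by (simp add: poly_eq_iff coeff_map_poly)

lemma coprime_map_poly_to_ac:
  assumes "coprime p q"
  shows "coprime (map_poly to_ac p) (map_poly to_ac q)"
proof -
  obtain a b where "a * p + b * q = 1"
    using coprime_poly_bezout[OF assms] .
  then have "map_poly to_ac (a * p + b * q) = 1" by simp
  then show ?thesis
    by (metis bezout_imp_coprime dvd_refl map_poly_to_ac_add map_poly_to_ac_mult)
qed

lemma
  shows rat_den_nonzero: "rat_den f \<noteq> 0"
    and coprime_rat_num_den: "coprime (rat_num f) (rat_den f)"
    and Fract_rat_num_den: "Fract (rat_num f) (rat_den f) = f"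
  using reduced_rep_num_den[of f] by (auto simp: reduced_rep_def)

text \<open>\<open>rat_to_ac\<close> uses a chosen fraction in lowest terms. Cross-multiplication
  carries over to the closure, so any other fraction serves as well.\<close>

lemma rat_to_ac_Fract:
  assumes "q \<noteq> 0"
  shows "rat_to_ac (Fract p q) = Fract (map_poly to_ac p) (map_poly to_ac q)"
proof -
  have "Fract (rat_num (Fract p q)) (rat_den (Fract p q)) = Fract p q"
    by (rule Fract_rat_num_den)
  then have "rat_num (Fract p q) * q = p * rat_den (Fract p q)"
    using assms by (simp add: eq_fract rat_den_nonzero)
  then show ?thesis
    using assms by (simp add: rat_to_ac_def eq_fract rat_den_nonzero flip: map_poly_to_ac_mult)
qed

section \<open>Equivalence as change of basis of a pencil\<close>

lemma rat_comp_linear_fractional: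
  fixes A B :: "'a::field poly"
  assumes num: "rat_num \<sigma> = [:b, a:]" and den: "rat_den \<sigma> = [:d, c:]" and "B \<noteq> 0"
  shows "rat_comp \<sigma> (Fract A B) = Fract (Polynomial.smult a A + Polynomial.smult b B)
           (Polynomial.smult c A + Polynomial.smult d B)"
proof -
  have eval: "poly (map_poly (\<lambda>c. to_fract [:c:]) [:y, x:]) (Fract A B)
        = Fract (Polynomial.smult x A + Polynomial.smult y B) B" for x y :: 'a
    using \<open>B \<noteq> 0\<close>
    by (subst map_poly_pCons) (auto simp: map_poly_pCons to_fract_def eq_fract Zero_fract_def algebra_simps)
  show ?thesis
    unfolding rat_comp_def num den eval
    using \<open>B \<noteq> 0\<close> by (simp add: mult_fract_cancel mult.commute)
qed

text \<open>By Cramer's rule a common divisor of the combinations divides the determinant times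
  \<open>p\<close> and times \<open>q\<close>.\<close>

lemma coprime_linear_combinations:
  fixes p q :: "'a::field poly"
  assumes "coprime p q" and det: "a * d - b * c \<noteq> 0"
  shows "coprime (Polynomial.smult a p + Polynomial.smult b q)
           (Polynomial.smult c p + Polynomial.smult d q)" (is "coprime ?r ?s")
proof (rule coprimeI)
  fix e assume e: "e dvd ?r" "e dvd ?s"
  have "e dvd Polynomial.smult d ?r - Polynomial.smult b ?s"
    using e by (intro dvd_diff dvd_smult)
  also have "\<dots> = Polynomial.smult (a * d - b * c) p"
    by (simp add: smult_add_right smult_diff_left mult.commute)
  finally have "e dvd p"
    using det by (simp add: dvd_smult_iff)
  have "e dvd Polynomial.smult a ?s - Polynomial.smult c ?r"
    using e by (intro dvd_diff dvd_smult)
  also have "\<dots> = Polynomial.smult (a * d - b * c) q"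
    by (simp add: smult_add_right smult_diff_left mult.commute)
  finally have "e dvd q"
    using det by (simp add: dvd_smult_iff)
  with \<open>e dvd p\<close> assms(1) show "is_unit e"
    by (meson coprime_common_divisor)
qed

text \<open>If \<open>x\<close> is nonzero, \<open>q\<close> divides \<open>p\<close> and hence is a
  unit. Thus numerator and denominator of a nonconstant function in lowest terms are linearly
  independent.\<close>

lemma coprime_proportional_imp_degree_0:
  fixes p q :: "'a::field poly"
  assumes "coprime p q" "Polynomial.smult x p = Polynomial.smult y q" "x \<noteq> 0 \<or> y \<noteq> 0"
  shows "max (Polynomial.degree p) (Polynomial.degree q) = 0"
proof -
  have *: "Polynomial.degree p = 0 \<and> Polynomial.degree q = 0"
    if "coprime p q" "Polynomial.smult x p = Polynomial.smult y q" "x \<noteq> 0"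
    for p q :: "'a poly" and x y
  proof -
    have "q dvd Polynomial.smult x p"
      unfolding that(2) by (rule dvd_smult) simp
    then have "q dvd p"
      using that(3) by (simp add: dvd_smult_iff)
    then have "q dvd 1"
      using that(1) by (meson coprime_common_divisor dvd_refl)
    then have q: "Polynomial.degree q = 0"
      using is_unit_iff_degree[of q] by (cases "q = 0") auto
    have "Polynomial.degree (Polynomial.smult x p) = 0"
      unfolding that(2) using q by simp
    with q that(3) show ?thesis by simp
  qed
  show ?thesis
  proof (cases "x = 0")
    case True
    with assms show ?thesis using *[of q p y x] by (simp add: coprime_commute)
  next
    case False
    with assms show ?thesis using *[of p q x y] by simp
  qed
qed

lemma degree_le_1_poly:
  assumes "Polynomial.degree p \<le> 1"
  shows "p = [:Polynomial.coeff p 0, Polynomial.coeff p 1:]"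
  using assms by (intro poly_eqI) (auto simp: coeff_pCons coeff_eq_0 split: nat.split)

lemma rat_equivE:
  fixes A B :: "'a::field poly"
  assumes "rat_equiv f (Fract A B)" "B \<noteq> 0"
  obtains a b c d where "a * d - b * c \<noteq> 0"
    "f = Fract (Polynomial.smult a A + Polynomial.smult b B)
           (Polynomial.smult c A + Polynomial.smult d B)"
proof -
  obtain \<sigma> where \<sigma>: "rat_degree \<sigma> = 1" "f = rat_comp \<sigma> (Fract A B)"
    using assms by (auto simp: rat_equiv_def)
  have "Polynomial.degree (rat_num \<sigma>) \<le> 1" "Polynomial.degree (rat_den \<sigma>) \<le> 1"
    using \<sigma>(1) unfolding rat_degree_def by (metis max.cobounded1, metis max.cobounded2)
  then obtain a b c d where num: "rat_num \<sigma> = [:b, a:]" and den: "rat_den \<sigma> = [:d, c:]"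
    by (metis degree_le_1_poly)
  have "a * d - b * c \<noteq> 0"
  proof
    \<comment> \<open>A singular matrix would make numerator and denominator of
      \<open>\<sigma>\<close> proportional, so \<open>\<sigma>\<close> would have degree 0. Of the
      two relations below, one is nontrivial because the denominator is not zero.\<close>
    assume det: "a * d - b * c = 0"
    have "Polynomial.smult c (rat_num \<sigma>) = Polynomial.smult a (rat_den \<sigma>)"
      "Polynomial.smult d (rat_num \<sigma>) = Polynomial.smult b (rat_den \<sigma>)"
      using det by (simp_all add: num den mult.commute)
    moreover have "c \<noteq> 0 \<or> d \<noteq> 0"
      using rat_den_nonzero[of \<sigma>] den by auto
    ultimately have "rat_degree \<sigma> = 0"
      unfolding rat_degree_def
      using coprime_proportional_imp_degree_0 coprime_rat_num_den by metis
    with \<sigma>(1) show False by simp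
  qed
  with that rat_comp_linear_fractional[OF num den assms(2)] \<sigma>(2) show thesis by blast
qed

lemma rat_equivI:
  fixes A B :: "'a::field poly"
  assumes det: "a * d - b * c \<noteq> 0" and "B \<noteq> 0"
  shows "rat_equiv (Fract (Polynomial.smult a A + Polynomial.smult b B)
           (Polynomial.smult c A + Polynomial.smult d B)) (Fract A B)"
proof -
  define \<sigma> where "\<sigma> = Fract [:b, a:] [:d, c:]"
  \<comment> \<open>These are invertible combinations of the coprime polynomials $z$ and
    $1$.\<close>
  have "coprime [:b, a:] [:d, c:]"
    using coprime_linear_combinations[of "[:0, 1:]" 1 a d b c] det by simp
  moreover have "[:d, c:] \<noteq> 0"
    using det by auto
  ultimately have "reduced_rep \<sigma> ([:b, a:], [:d, c:])"
    by (simp add: reduced_rep_def \<sigma>_def)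
  then obtain e where e: "e \<noteq> 0" "rat_num \<sigma> = Polynomial.smult e [:b, a:]"
    "rat_den \<sigma> = Polynomial.smult e [:d, c:]"
    by (rule reduced_rep_unique)
  have "rat_degree \<sigma> = 1"
    using e det by (auto simp: rat_degree_def)
  moreover have "rat_comp \<sigma> (Fract A B) =
      Fract ([:e:] * (Polynomial.smult a A + Polynomial.smult b B))
        ([:e:] * (Polynomial.smult c A + Polynomial.smult d B))"
    using rat_comp_linear_fractional[of \<sigma> "e * b" "e * a" "e * d" "e * c" B A] e assms(2)
    by (simp add: smult_add_right)
  moreover have "\<dots> = Fract (Polynomial.smult a A + Polynomial.smult b B)
        (Polynomial.smult c A + Polynomial.smult d B)"
    using e(1) by (intro mult_fract_cancel) simp
  ultimately show ?thesis
    unfolding rat_equiv_def by metis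
qed

section \<open>Wronskian and Plucker coordinates\<close>

text \<open>This is minus the numerator of $(p/q)'$. With this sign its coefficients are nonnegative
  combinations of the \<open>plucker p q i j\<close> with $i < j$.\<close>

definition wronskian :: "'a::idom poly \<Rightarrow> 'a poly \<Rightarrow> 'a poly" where
  "wronskian p q = p * pderiv q - pderiv p * q"

definition plucker :: "'a::comm_ring_1 poly \<Rightarrow> 'a poly \<Rightarrow> nat \<Rightarrow> nat \<Rightarrow> 'a" where
  "plucker p q i j = Polynomial.coeff p i * Polynomial.coeff q j - Polynomial.coeff p j * Polynomial.coeff q i"

lemma wronskian_smult:
  "wronskian (Polynomial.smult c p) (Polynomial.smult c q) = Polynomial.smult (c\<^sup>2) (wronskian p q)"
  by (simp add: wronskian_def pderiv_smult smult_diff_right power2_eq_square)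

lemma plucker_smult:
  "plucker (Polynomial.smult c p) (Polynomial.smult c q) i j = c\<^sup>2 * plucker p q i j"
  by (simp add: plucker_def power2_eq_square algebra_simps)

lemma degree_le_3_poly:
  assumes "Polynomial.degree p \<le> 3"
  shows "p = [:Polynomial.coeff p 0, Polynomial.coeff p 1, Polynomial.coeff p 2, Polynomial.coeff p 3:]"
  using assms
  by (intro poly_eqI) (auto simp: coeff_pCons coeff_eq_0 numeral_2_eq_2 numeral_3_eq_3 split: nat.split)

text \<open>The coefficient of $z^k$ is the sum of $(j - i)$ \<open>plucker p q i j\<close> over $i
  < j$ with $i + j = k + 1$. Only the coordinates 03 and 12 share a coefficient.\<close>

lemma wronskian_cubic:
  fixes p q :: "'a::idom poly"
  assumes "Polynomial.degree p \<le> 3" "Polynomial.degree q \<le> 3"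
  shows "wronskian p q = [:plucker p q 0 1, 2 * plucker p q 0 2,
           3 * plucker p q 0 3 + plucker p q 1 2, 2 * plucker p q 1 3, plucker p q 2 3:]"
proof -
  have *: "wronskian [:p0, p1, p2, p3:] [:q0, q1, q2, q3:] =
      [:p0 * q1 - p1 * q0, 2 * (p0 * q2 - p2 * q0),
        3 * (p0 * q3 - p3 * q0) + (p1 * q2 - p2 * q1), 2 * (p1 * q3 - p3 * q1), p2 * q3 - p3 * q2:]"
    for p0 p1 p2 p3 q0 q1 q2 q3 :: 'a
    by (simp add: wronskian_def pderiv_pCons algebra_simps)
  show ?thesis
    unfolding plucker_def *[symmetric]
    using degree_le_3_poly[OF assms(1)] degree_le_3_poly[OF assms(2)] by metis
qed

section \<open>Critical points as zeros of the Wronskian\<close>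

lemma order_gt_1_iff:
  fixes p :: "'a::field poly"
  assumes "p \<noteq> 0"
  shows "Polynomial.order x p > 1 \<longleftrightarrow> poly p x = 0 \<and> poly (pderiv p) x = 0"
proof (cases "poly p x = 0")
  case False
  then show ?thesis by (simp add: order_0I)
next
  case True
  then obtain h where h: "p = [:-x, 1:] * h"
    by (metis dvdE poly_eq_0_iff_dvd)
  have "h \<noteq> 0"
    using assms h by auto
  have "Polynomial.order x p = Polynomial.order x [:-x, 1:] + Polynomial.order x h"
    using assms unfolding h by (rule order_mult)
  also have "Polynomial.order x [:-x, 1:] = 1"
    using order_power_n_n[of x 1] by simp
  finally have "Polynomial.order x p > 1 \<longleftrightarrow> poly h x = 0"
    using order_gt_0_iff[OF \<open>h \<noteq> 0\<close>, of x] by simp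
  moreover have "poly (pderiv p) x = poly h x"
    unfolding h pderiv_mult by (simp add: pderiv_pCons)
  ultimately show ?thesis using True by simp
qed

text \<open>At a pole the Wronskian takes the value $p(x) q'(x)$ with $p(x) \<noteq> 0$. Elsewhere,
  with $c = f(x)$, it takes the value $-q(x) (p - c q)'(x)$.\<close>

lemma ram_index_gt_1_iff_wronskian:
  fixes f :: "'a::field poly fract"
  assumes "rat_degree f > 0"
  shows "ram_index f (Fin x) > 1 \<longleftrightarrow> poly (wronskian (rat_num f) (rat_den f)) x = 0"
proof -
  let ?p = "rat_num f" and ?q = "rat_den f"
  note cop = coprime_rat_num_den[of f]
  show ?thesis
  proof (cases "poly ?q x = 0")
    case True
    have "poly ?p x \<noteq> 0"
    proof
      assume "poly ?p x = 0"
      then have "[:-x, 1:] dvd 1"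
        using True cop by (metis coprime_common_divisor poly_eq_0_iff_dvd)
      then show False using is_unit_iff_degree[of "[:-x, 1:]"] by simp
    qed
    then show ?thesis
      using True order_gt_1_iff[OF rat_den_nonzero[of f], of x] by (simp add: wronskian_def)
  next
    case False
    define c where "c = poly ?p x / poly ?q x"
    have c: "poly ?p x = c * poly ?q x"
      using False by (simp add: c_def)
    have "?p - Polynomial.smult c ?q \<noteq> 0"
      using coprime_proportional_imp_degree_0[OF cop, of 1 c] assms
      unfolding rat_degree_def by (metis eq_iff_diff_eq_0 less_irrefl one_neq_zero smult_1_left)
    from order_gt_1_iff[OF this, of x]
    have "ram_index f (Fin x) > 1 \<longleftrightarrow> poly (pderiv ?p) x = c * poly (pderiv ?q) x"
      using False c by (simp add: c_def[symmetric] pderiv_diff pderiv_smult)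
    moreover have "poly (wronskian ?p ?q) x =
        poly ?q x * (c * poly (pderiv ?q) x - poly (pderiv ?p) x)"
      by (simp add: wronskian_def c algebra_simps)
    then have "poly (pderiv ?p) x = c * poly (pderiv ?q) x \<longleftrightarrow> poly (wronskian ?p ?q) x = 0"
      using False by auto
    ultimately show ?thesis by blast
  qed
qed

section \<open>Plucker coordinates and the field of definition\<close>

lemma plucker_nonzero:
  fixes p q :: "'a::field poly"
  assumes "coprime p q" "max (Polynomial.degree p) (Polynomial.degree q) > 0"
  obtains i j where "plucker p q i j \<noteq> 0"
proof -
  have "\<exists>i j. plucker p q i j \<noteq> 0"
  proof (rule ccontr)
    assume "\<nexists>i j. plucker p q i j \<noteq> 0"
    then have "Polynomial.smult (Polynomial.coeff q i) p = Polynomial.smult (Polynomial.coeff p i) q" for i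
      by (intro poly_eqI) (auto simp: plucker_def mult.commute)
    then have "Polynomial.coeff q i = 0 \<and> Polynomial.coeff p i = 0" for i
      using coprime_proportional_imp_degree_0[OF assms(1)] assms(2) by (metis less_irrefl)
    then have "p = 0" "q = 0"
      by (auto intro: poly_eqI)
    with assms(2) show False by simp
  qed
  with that show thesis by blast
qed

text \<open>Two rows of the skew-symmetric Plucker matrix, divided by \<open>c\<close>, have
  coefficients in the subfield. They form a basis of the pencil when the entry where they meet is
  nonzero.\<close>

lemma rat_equiv_if_plucker_rational:
  fixes p q :: "'k::field alg_closure poly"
  assumes rational: "\<And>i j. plucker p q i j \<in> range (\<lambda>k. c * to_ac k)"
    and nonzero: "plucker p q i j \<noteq> 0"
  shows "\<exists>g :: 'k poly fract. rat_equiv (Fract p q) (rat_to_ac g)"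
proof -
  txt \<open>The pencil contains the members whose coefficients are the rows of the Plucker matrix.\<close>
  define row where "row i = Polynomial.smult (1 / c)
    (Polynomial.smult (Polynomial.coeff p i) q - Polynomial.smult (Polynomial.coeff q i) p)" for i
  have "c \<noteq> 0"
    using rational[of i j] nonzero by auto
  have coeff_row: "Polynomial.coeff (row i) j = plucker p q i j / c" for i j
    by (simp add: row_def plucker_def mult.commute)
  have row: "map_poly to_ac (map_poly of_ac (row i)) = row i" for i
  proof (rule poly_eqI)
    fix j
    have "Polynomial.coeff (row i) j \<in> range to_ac"
      unfolding coeff_row using rational[of i j] \<open>c \<noteq> 0\<close> by auto
    then show "Polynomial.coeff (map_poly to_ac (map_poly of_ac (row i))) j = Polynomial.coeff (row i) j"
      by (simp add: coeff_map_poly to_ac_of_ac)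
  qed
  have "Polynomial.coeff (row j) i \<noteq> 0"
    using nonzero \<open>c \<noteq> 0\<close> by (auto simp: coeff_row plucker_def mult.commute)
  then have "row j \<noteq> 0" by auto
  define e where "e = plucker p q i j / c"
  have "e \<noteq> 0"
    using nonzero \<open>c \<noteq> 0\<close> by (simp add: e_def)
  \<comment> \<open>This inverts the change of basis: in $p_j r_i - p_i r_j$, with $r_i$ for
    \<open>row i\<close>, the multiples of \<open>q\<close> cancel and \<open>e\<close> times
    \<open>p\<close> remains.\<close>
  have p: "Polynomial.smult (Polynomial.coeff p j) (row i) + Polynomial.smult (- Polynomial.coeff p i) (row j)
      = [:e:] * p"
    by (rule poly_eqI) (simp add: row_def e_def plucker_def field_simps \<open>c \<noteq> 0\<close>)
  have q: "Polynomial.smult (Polynomial.coeff q j) (row i) + Polynomial.smult (- Polynomial.coeff q i) (row j)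
      = [:e:] * q"
    by (rule poly_eqI) (simp add: row_def e_def plucker_def field_simps \<open>c \<noteq> 0\<close>)
  have "rat_equiv (Fract ([:e:] * p) ([:e:] * q)) (Fract (row i) (row j))"
    unfolding p[symmetric] q[symmetric]
    by (rule rat_equivI) (use nonzero \<open>row j \<noteq> 0\<close> in \<open>auto simp: plucker_def\<close>)
  moreover have "Fract ([:e:] * p) ([:e:] * q) = Fract p q"
    using \<open>e \<noteq> 0\<close> by (intro mult_fract_cancel) simp
  moreover have "map_poly of_ac (row j) \<noteq> 0"
    using row[of j] \<open>row j \<noteq> 0\<close> by auto
  then have "rat_to_ac (Fract (map_poly of_ac (row i)) (map_poly of_ac (row j))) = Fract (row i) (row j)"
    by (simp add: rat_to_ac_Fract row)
  ultimately show ?thesis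
    by metis
qed

text \<open>A change of basis multiplies all Plucker coordinates by its determinant, and a common
  scalar on numerator and denominator multiplies them by its square.\<close>

lemma plucker_rational_if_rat_equiv:
  fixes p q :: "'k::field alg_closure poly" and g :: "'k poly fract"
  assumes "reduced_rep f (p, q)" "f \<noteq> 0" "rat_equiv f (rat_to_ac g)"
  obtains c where "\<And>i j. plucker p q i j = c * to_ac (plucker (rat_num g) (rat_den g) i j)"
proof -
  define A B where "A = map_poly to_ac (rat_num g)" and "B = map_poly to_ac (rat_den g)"
  have "B \<noteq> 0" "coprime A B"
    using rat_den_nonzero[of g] coprime_rat_num_den[of g]
    by (simp_all add: A_def B_def coprime_map_poly_to_ac)
  obtain a b c d where det: "a * d - b * c \<noteq> 0"
    and f: "f = Fract (Polynomial.smult a A + Polynomial.smult b B)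
           (Polynomial.smult c A + Polynomial.smult d B)" (is "f = Fract ?r ?s")
    using assms(3) \<open>B \<noteq> 0\<close> unfolding rat_to_ac_def A_def[symmetric] B_def[symmetric]
    by (rule rat_equivE)
  \<comment> \<open>A fraction with denominator 0 is 0 by convention.\<close>
  have "?s \<noteq> 0"
    using f \<open>f \<noteq> 0\<close> by (metis fract_collapse(3))
  then have "reduced_rep f (?r, ?s)"
    using coprime_linear_combinations[OF \<open>coprime A B\<close> det] f by (simp add: reduced_rep_def)
  then obtain x where x: "x \<noteq> 0" "rat_num f = Polynomial.smult x ?r" "rat_den f = Polynomial.smult x ?s"
    by (rule reduced_rep_unique)
  obtain y where y: "y \<noteq> 0" "rat_num f = Polynomial.smult y p" "rat_den f = Polynomial.smult y q"
    using assms(1) by (rule reduced_rep_unique)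
  have "plucker p q i j = (x\<^sup>2 / y\<^sup>2 * (a * d - b * c)) * to_ac (plucker (rat_num g) (rat_den g) i j)" for i j
  proof -
    have "y\<^sup>2 * plucker p q i j = x\<^sup>2 * plucker ?r ?s i j"
      unfolding plucker_smult[symmetric] x(2,3)[symmetric] y(2,3)[symmetric] ..
    also have "plucker ?r ?s i j = (a * d - b * c) * plucker A B i j"
      by (simp add: plucker_def algebra_simps)
    also have "plucker A B i j = to_ac (plucker (rat_num g) (rat_den g) i j)"
      by (simp add: plucker_def A_def B_def coeff_map_poly)
    finally show ?thesis
      using y(1) by (simp add: field_simps)
  qed
  with that show thesis by blast
qed

section \<open>Split quartics and their invariant\<close>

text \<open>
  The $n$ linear forms $a z + b$ include the constant form $1$, which stands for a root at
  infinity when the degree is less than $n$.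
\<close>
lemma splits_over_subfield:
  fixes W :: "'k::field alg_closure poly"
  assumes "Polynomial.degree W \<le> n" "\<And>x. poly W x = 0 \<Longrightarrow> x \<in> range to_ac"
  shows "\<exists>c L. length L = n \<and> W = Polynomial.smult c (map_poly to_ac (\<Prod>(a, b)\<leftarrow>L. [:b, a:]))"
  using assms
proof (induction n arbitrary: W)
  case 0
  then obtain c where "W = [:c:]"
    using degree_eq_zeroE by blast
  then show ?case by (intro exI[of _ c] exI[of _ "[]"]) simp
next
  case (Suc n)
  show ?case
  proof (cases "Polynomial.degree W = 0")
    case True
    then obtain c L where "length L = n"
      "W = Polynomial.smult c (map_poly to_ac (\<Prod>(a, b)\<leftarrow>L. [:b, a:]))"
      using Suc.IH[of W] Suc.prems by auto
    then show ?thesis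
      by (intro exI[of _ c] exI[of _ "(0, 1) # L"]) (simp flip: one_pCons)
  next
    case False
    then obtain x where x: "poly W x = 0"
      using alg_closed_imp_poly_has_root by blast
    then obtain k where k: "x = to_ac k"
      using Suc.prems by blast
    obtain V where V: "W = [:-x, 1:] * V"
      using x by (metis dvdE poly_eq_0_iff_dvd)
    have "V \<noteq> 0"
      using V False by auto
    then have "Polynomial.degree V \<le> n"
      using Suc.prems(1) V by (subst (asm) V, subst (asm) degree_mult_eq) auto
    then obtain c L where "length L = n"
      "V = Polynomial.smult c (map_poly to_ac (\<Prod>(a, b)\<leftarrow>L. [:b, a:]))"
      using Suc.IH[of V] Suc.prems(2) V by auto
    moreover have "[:-x, 1:] = map_poly to_ac [:-k, 1:]"
      by (simp add: k map_poly_pCons)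
    ultimately show ?thesis
      using V
      by (intro exI[of _ c] exI[of _ "(1, -k) # L"]) (simp only: map_poly_to_ac_mult
        list.map prod_list.Cons prod.case length_Cons mult_smult_right simp_thms)
  qed
qed

text \<open>This is 12 times the classical invariant $I = a e - 4 b d + 3 c^2$ of the binary quartic
  with coefficients $a, 4b, 6c, 4d, e$.\<close>

definition quartic_invariant :: "'a::comm_ring_1 poly \<Rightarrow> 'a" where
  "quartic_invariant w = (Polynomial.coeff w 2)\<^sup>2 - 3 * Polynomial.coeff w 1 * Polynomial.coeff w 3
     + 12 * Polynomial.coeff w 0 * Polynomial.coeff w 4"

text \<open>Where \<open>B\<close> is nonzero, $A/B$ is a cross-ratio of the four roots, and the
  value is $B^2 (c^2 - c + 1)$ for $c = A/B$.\<close>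

lemma quartic_invariant_product:
  fixes a1 b1 a2 b2 a3 b3 a4 b4 :: "'a::comm_ring_1"
  defines "A \<equiv> (a1 * b2 - a2 * b1) * (a3 * b4 - a4 * b3)"
    and "B \<equiv> (a1 * b3 - a3 * b1) * (a2 * b4 - a4 * b2)"
  shows "quartic_invariant ([:b1, a1:] * ([:b2, a2:] * ([:b3, a3:] * [:b4, a4:]))) = A\<^sup>2 - A * B + B\<^sup>2"
  unfolding quartic_invariant_def A_def B_def
  by (simp add: eval_nat_numeral) (simp add: algebra_simps)

text \<open>Write $P_{ij}$ for the coordinates. The left side is $(3 P_{03} - P_{12})^2 = (3 P_{03}
  + P_{12})^2 - 12 P_{03} P_{12}$, and the Plucker relation gives $P_{03} P_{12} = P_{02} P_{13} -
  P_{01} P_{23}$.\<close>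

lemma plucker_03_quadratic:
  fixes p q :: "'a::idom poly"
  assumes "Polynomial.degree p \<le> 3" "Polynomial.degree q \<le> 3"
  shows "(6 * plucker p q 0 3 - Polynomial.coeff (wronskian p q) 2)\<^sup>2 = quartic_invariant (wronskian p q)"
  unfolding wronskian_cubic[OF assms] quartic_invariant_def plucker_def
  by (simp add: eval_nat_numeral) (simp add: algebra_simps)


section \<open>Perfectness as a condition on squares\<close>

lemma perfect_wrt_iff_squares:
  "perfect_wrt (- Fract [:0, 2, 1:] [:3, 2:] :: 'k::field_char_0 poly fract)
     \<longleftrightarrow> (\<forall>c :: 'k. \<exists>s. s\<^sup>2 = c\<^sup>2 - c + 1)"
proof -
  define \<phi> :: "'k poly fract" where "\<phi> = - Fract [:0, 2, 1:] [:3, 2:]"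
  have "[:4:] * [:0, -2, -1:] + [:1, 2:] * [:3, 2:] = ([:3:] :: 'k poly)"
    by simp
  then have "coprime [:0, -2, -1:] ([:3, 2:] :: 'k poly)"
    by (intro bezout_imp_coprime[of "[:4:]" _ "[:1, 2:]"]) (simp add: is_unit_const_poly_iff dvd_field_iff)
  then have "reduced_rep \<phi> ([:0, -2, -1:], [:3, 2:])"
    by (simp add: reduced_rep_def \<phi>_def)
  then obtain e where e: "e \<noteq> 0" "rat_num \<phi> = Polynomial.smult e [:0, -2, -1:]"
    "rat_den \<phi> = Polynomial.smult e [:3, 2:]"
    by (rule reduced_rep_unique)
  have eval_Infty: "rat_eval \<phi> Infty = Infty"
    using e by simp
  have eval_Fin: "rat_eval \<phi> (Fin x) = Fin c \<longleftrightarrow> (x + 1 + c)\<^sup>2 = c\<^sup>2 - c + 1" for x c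
  proof (cases "3 + 2 * x = 0")
    case True
    then have x: "x = - 3 / 2"
      by (simp add: field_simps add_eq_0_iff)
    \<comment> \<open>At the pole the quadratic equation must fail for every \<open>c\<close>; the
      difference of its sides does not depend on \<open>c\<close> there.\<close>
    have "(x + 1 + c)\<^sup>2 - (c\<^sup>2 - c + 1) = - 3 / 4"
      unfolding x by (simp add: power2_eq_square field_simps)
    moreover have "poly (rat_den \<phi>) x = e * (3 + 2 * x)"
      by (simp add: e(3) algebra_simps)
    then have "rat_eval \<phi> (Fin x) = Infty"
      using True by simp
    ultimately show ?thesis by auto
  next
    case False
    have "poly (rat_num \<phi>) x = e * - (x\<^sup>2 + 2 * x)" "poly (rat_den \<phi>) x = e * (3 + 2 * x)"
      by (simp_all add: e(2,3) power2_eq_square algebra_simps)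
    with False e(1) have "rat_eval \<phi> (Fin x) = Fin (- (x\<^sup>2 + 2 * x) / (3 + 2 * x))"
      by (simp only: rat_eval.simps mult_eq_0_iff mult_divide_mult_cancel_left simp_thms if_False)
    also have "\<dots> = Fin c \<longleftrightarrow> - (x\<^sup>2 + 2 * x) = c * (3 + 2 * x)"
      using False by (simp add: divide_eq_eq)
    also have "\<dots> \<longleftrightarrow> (x + 1 + c)\<^sup>2 - (c\<^sup>2 - c + 1) = 0"
    proof -
      have "(x + 1 + c)\<^sup>2 - (c\<^sup>2 - c + 1) = c * (3 + 2 * x) - - (x\<^sup>2 + 2 * x)"
        by (simp add: power2_eq_square algebra_simps)
      then show ?thesis by (metis eq_iff_diff_eq_0)
    qed
    also have "\<dots> \<longleftrightarrow> (x + 1 + c)\<^sup>2 = c\<^sup>2 - c + 1"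
      by (rule eq_iff_diff_eq_0[symmetric])
    finally show ?thesis .
  qed
  have "surj (rat_eval \<phi>) \<longleftrightarrow> (\<forall>c :: 'k. \<exists>s. s\<^sup>2 = c\<^sup>2 - c + 1)"
  proof
    assume surj: "surj (rat_eval \<phi>)"
    show "\<forall>c :: 'k. \<exists>s. s\<^sup>2 = c\<^sup>2 - c + 1"
    proof
      fix c :: 'k
      obtain y where y: "rat_eval \<phi> y = Fin c"
        using surj by (metis surjD)
      with eval_Infty obtain x where "y = Fin x"
        by (cases y) auto
      with y eval_Fin show "\<exists>s. s\<^sup>2 = c\<^sup>2 - c + 1" by blast
    qed
  next
    assume squares: "\<forall>c :: 'k. \<exists>s. s\<^sup>2 = c\<^sup>2 - c + 1"
    have "\<exists>x. rat_eval \<phi> x = y" for y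
    proof (cases y)
      case Infty
      with eval_Infty show ?thesis by blast
    next
      case (Fin c)
      obtain s where "s\<^sup>2 = c\<^sup>2 - c + 1"
        using squares by blast
      then have "rat_eval \<phi> (Fin (s - 1 - c)) = Fin c"
        unfolding eval_Fin by simp
      with Fin show ?thesis by blast
    qed
    then show "surj (rat_eval \<phi>)"
      by (metis surjI)
  qed
  then show ?thesis
    by (simp add: perfect_wrt_def \<phi>_def)
qed

section \<open>The two implications\<close>

text \<open>The scalar \<open>c\<close> split off from the Wronskian is the common factor of all
  Plucker coordinates. The hypothesis, applied to a cross-ratio of the critical points, supplies the
  square root that separates the coordinates 03 and 12.\<close>

lemma rational_if_squares:
  fixes f :: "'k::field_char_0 alg_closure poly fract"
  assumes squares: "\<forall>c :: 'k. \<exists>s. s\<^sup>2 = c\<^sup>2 - c + 1"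
    and "rat_degree f = 3" and crit: "critical_points f \<subseteq> range (map_p1 to_ac)"
  shows "\<exists>g :: 'k poly fract. rat_equiv f (rat_to_ac g)"
proof -
  define p q where "p = rat_num f" and "q = rat_den f"
  have max_deg: "max (Polynomial.degree p) (Polynomial.degree q) = 3"
    using assms(2) by (simp add: rat_degree_def p_def q_def)
  then have deg: "Polynomial.degree p \<le> 3" "Polynomial.degree q \<le> 3"
    by (metis max.cobounded1, metis max.cobounded2)
  define W where "W = wronskian p q"
  note W = wronskian_cubic[OF deg, folded W_def]
  have "Polynomial.degree W \<le> 4"
    unfolding W by (intro degree_le) (auto simp: coeff_pCons split: nat.split)
  moreover have "x \<in> range to_ac" if "poly W x = 0" for x
  proof -
    have "Fin x \<in> critical_points f"
      using that ram_index_gt_1_iff_wronskian[of f x] assms(2)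
      by (simp add: critical_points_def W_def p_def q_def del: ram_index.simps)
    then obtain y where y: "Fin x = map_p1 to_ac y"
      using crit by blast
    then show ?thesis by (cases y) auto
  qed
  ultimately obtain c and L :: "('k \<times> 'k) list" where L: "length L = 4"
    "W = Polynomial.smult c (map_poly to_ac (\<Prod>(a, b)\<leftarrow>L. [:b, a:]))"
    using splits_over_subfield by blast
  obtain a1 b1 a2 b2 a3 b3 a4 b4 where "L = [(a1, b1), (a2, b2), (a3, b3), (a4, b4)]"
    using L(1) by (auto simp: eval_nat_numeral length_Suc_conv)
  define P where "P = [:b1, a1:] * ([:b2, a2:] * ([:b3, a3:] * [:b4, a4:]))"
  have WP: "W = Polynomial.smult c (map_poly to_ac P)"
    unfolding L(2) P_def \<open>L = _\<close> by simp
  obtain t where t: "quartic_invariant P = t\<^sup>2"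
  proof -
    define A where "A = (a1 * b2 - a2 * b1) * (a3 * b4 - a4 * b3)"
    define B where "B = (a1 * b3 - a3 * b1) * (a2 * b4 - a4 * b2)"
    have inv: "quartic_invariant P = A\<^sup>2 - A * B + B\<^sup>2"
      unfolding P_def A_def B_def by (rule quartic_invariant_product)
    show thesis
    proof (cases "B = 0")
      case True
      with inv that[of A] show thesis by simp
    next
      case False
      obtain s where "s\<^sup>2 = (A / B)\<^sup>2 - A / B + 1"
        using squares by blast
      then have "quartic_invariant P = (B * s)\<^sup>2"
        using False by (simp add: inv power_mult_distrib) (simp add: field_simps power2_eq_square)
      with that show thesis by blast
    qed
  qed
  have w: "Polynomial.coeff W i = c * to_ac (Polynomial.coeff P i)" for i
    by (simp add: WP coeff_map_poly)
  have "(6 * plucker p q 0 3 - Polynomial.coeff W 2)\<^sup>2 = quartic_invariant W"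
    unfolding W_def by (rule plucker_03_quadratic[OF deg])
  also have "\<dots> = c\<^sup>2 * to_ac (quartic_invariant P)"
    unfolding quartic_invariant_def w by (simp add: algebra_simps power2_eq_square)
  also have "\<dots> = (c * to_ac t)\<^sup>2"
    by (simp add: t power_mult_distrib)
  finally have "6 * plucker p q 0 3 - Polynomial.coeff W 2 = c * to_ac t
      \<or> 6 * plucker p q 0 3 - Polynomial.coeff W 2 = c * to_ac (- t)"
    by (simp add: power2_eq_iff)
  \<comment> \<open>Either sign of the square root gives an element of \<open>c\<close> times the
    subfield.\<close>
  then obtain t' where "6 * plucker p q 0 3 - Polynomial.coeff W 2 = c * to_ac t'"
    by blast
  then have p03: "6 * plucker p q 0 3 = c * (to_ac (Polynomial.coeff P 2) + to_ac t')"
    by (simp add: w algebra_simps)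
  have "Polynomial.coeff W 2 = 3 * plucker p q 0 3 + plucker p q 1 2"
    by (simp add: W eval_nat_numeral)
  then have "2 * plucker p q 1 2 = 2 * Polynomial.coeff W 2 - 6 * plucker p q 0 3"
    by (simp add: algebra_simps)
  then have p12: "2 * plucker p q 1 2 = c * (to_ac (Polynomial.coeff P 2) - to_ac t')"
    unfolding p03 w by (simp add: algebra_simps)
  define S where "S = range (\<lambda>k. c * to_ac (k :: 'k))"
  have SI: "x \<in> S" if "x = c * to_ac k" for x k
    using that by (auto simp: S_def)
  have S01: "plucker p q 0 1 \<in> S"
    using w[of 0] by (intro SI[of _ "Polynomial.coeff P 0"]) (simp add: W)
  have S02: "plucker p q 0 2 \<in> S"
    using w[of 1] by (intro SI[of _ "Polynomial.coeff P 1 / 2"]) (simp add: W field_simps)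
  have S03: "plucker p q 0 3 \<in> S"
    using p03 by (intro SI[of _ "(Polynomial.coeff P 2 + t') / 6"]) (simp add: field_simps)
  have S12: "plucker p q 1 2 \<in> S"
    using p12 by (intro SI[of _ "(Polynomial.coeff P 2 - t') / 2"]) (simp add: field_simps)
  have S13: "plucker p q 1 3 \<in> S"
    using w[of 3]
    by (intro SI[of _ "Polynomial.coeff P 3 / 2"]) (simp add: W field_simps eval_nat_numeral)
  have S23: "plucker p q 2 3 \<in> S"
    using w[of 4] by (intro SI[of _ "Polynomial.coeff P 4"]) (simp add: W eval_nat_numeral)
  have less: "plucker p q i j \<in> S" if "i < j" "j \<le> 3" for i j
  proof -
    have "j = 1 \<or> j = 2 \<or> j = 3" "i = 0 \<or> i = 1 \<or> i = 2"
      using that by auto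
    with that S01 S02 S03 S12 S13 S23 show ?thesis by auto
  qed
  have "plucker p q i j \<in> S" for i j
  proof -
    have zero: "0 \<in> S"
      by (rule SI[of _ 0]) simp
    \<comment> \<open>Coordinates on the diagonal or beyond the degree vanish; those below the
      diagonal follow by antisymmetry.\<close>
    have upper: "plucker p q i j \<in> S" if "i \<le> j" for i j
    proof (cases "i = j \<or> j > 3")
      case True
      then have "plucker p q i j = 0"
        using deg by (auto simp: plucker_def coeff_eq_0)
      with zero show ?thesis by simp
    next
      case False
      with that less show ?thesis by simp
    qed
    show ?thesis
    proof (cases "i \<le> j")
      case False
      then obtain k where "plucker p q j i = c * to_ac k"
        using upper[of j i] by (auto simp: S_def)
      moreover have "plucker p q i j = - plucker p q j i"
        by (simp add: plucker_def mult.commute)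
      ultimately show ?thesis
        by (intro SI[of _ "- k"]) simp
    qed (rule upper)
  qed
  moreover have "coprime p q"
    by (simp add: p_def q_def coprime_rat_num_den)
  then obtain i j where "plucker p q i j \<noteq> 0"
    using plucker_nonzero[of p q] max_deg by auto
  ultimately have "\<exists>g :: 'k poly fract. rat_equiv (Fract p q) (rat_to_ac g)"
    unfolding S_def by (rule rat_equiv_if_plucker_rational)
  then show ?thesis
    by (simp add: p_def q_def Fract_rat_num_den)
qed

text \<open>For a cubic with critical points 0, 1, $1/\<mu>$ and infinity, a ratio of Plucker
  coordinates determines the square root \<open>s\<close>. Descent puts this ratio, and with it
  \<open>s\<close>, in the subfield.\<close>

lemma squares_if_rational:
  fixes \<mu> :: "'k::field_char_0"
  assumes rational: "\<And>f :: 'k alg_closure poly fract. rat_degree f = 3 \<Longrightarrow>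
      critical_points f \<subseteq> range (map_p1 to_ac) \<Longrightarrow> \<exists>g :: 'k poly fract. rat_equiv f (rat_to_ac g)"
  shows "\<exists>s. s\<^sup>2 = \<mu>\<^sup>2 - \<mu> + 1"
\<comment> \<open>For these two values the four critical points would not be distinct.\<close>
proof (cases "\<mu> = 0 \<or> \<mu> = 1")
  case True
  then show ?thesis by (intro exI[of _ 1]) auto
next
  case False
  obtain s :: "'k alg_closure" where s: "s\<^sup>2 = to_ac (\<mu>\<^sup>2 - \<mu> + 1)"
    using nth_root_exists[of 2] by auto
  define m where "m = to_ac \<mu>"
  have m: "m \<noteq> 0" "m \<noteq> 1"
    using False to_ac_eq_iff[of \<mu> 1] by (auto simp: m_def simp del: to_ac_eq_iff)
  txt \<open>
    The function $z^2 (w z + 1) / (u z + 1)$ has the critical points $0$ and $\infty$; the other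
    two are $1$ and $1/\mu$ iff $u w = \mu$ and $u + 3 w = -2 (1 + \mu)$, which amounts to a
    quadratic equation for $w$.
  \<close>
  define w where "w = (s - 1 - m) / 3"
  have "s = 3 * w + 1 + m"
    by (simp add: w_def)
  with s have "(3 * w + 1 + m)\<^sup>2 = m\<^sup>2 - m + 1"
    by (simp add: m_def)
  moreover have "(3 * w + 1 + m)\<^sup>2 - (m\<^sup>2 - m + 1) = 3 * (3 * w\<^sup>2 + 2 * (1 + m) * w + m)"
    by (simp add: power2_eq_square algebra_simps)
  ultimately have "3 * (3 * w\<^sup>2 + 2 * (1 + m) * w + m) = 0"
    by (metis cancel_comm_monoid_add_class.diff_cancel)
  then have quad: "3 * w\<^sup>2 + 2 * (1 + m) * w + m = 0"
    by (simp only: mult_eq_0_iff) simp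
  have "w \<noteq> 0"
    using quad m by auto
  define u where "u = m / w"
  have uw: "u * w = m" and u3w: "u + 3 * w = - 2 * (1 + m)"
  proof -
    show "u * w = m"
      using \<open>w \<noteq> 0\<close> by (simp add: u_def)
    then have "w * (u + 3 * w + 2 * (1 + m)) = 0"
      using quad by (simp add: algebra_simps power2_eq_square)
    with \<open>w \<noteq> 0\<close> have "u + 3 * w + 2 * (1 + m) = 0"
      by (simp only: mult_eq_0_iff simp_thms)
    then show "u + 3 * w = - 2 * (1 + m)"
      unfolding mult_minus_left by (simp only: eq_neg_iff_add_eq_0)
  qed
  \<comment> \<open>Otherwise $w z + 1$ would cancel. Equality would force $w = -1$ and then $m =
    1$.\<close>
  have "u \<noteq> w"
  proof
    assume "u = w"
    have "2 * (w + 1)\<^sup>2 = (w + 3 * w) + 2 * (1 + w * w)"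
      by (simp add: power2_eq_square algebra_simps)
    also have "\<dots> = 0"
      using uw u3w unfolding \<open>u = w\<close> by simp
    finally have "w = - 1"
      by (simp add: add_eq_0_iff2)
    with \<open>u = w\<close> uw m show False by simp
  qed
  define p q where "p = [:0, 0, 1, w:]" and "q = [:1, u:]"
  define f where "f = Fract p q"
  \<comment> \<open>Division of $u^3 p$ by \<open>q\<close> leaves the remainder $u^3 p(-1/u) = u -
    w$.\<close>
  have "[:u ^ 3:] * p + [:u - w, - u * (u - w), - u\<^sup>2 * w:] * q = [:u - w:]"
    by (simp add: p_def q_def algebra_simps power2_eq_square power3_eq_cube)
  then have "coprime p q"
    using \<open>u \<noteq> w\<close>
    by (intro bezout_imp_coprime[of "[:u ^ 3:]" _ "[:u - w, - u * (u - w), - u\<^sup>2 * w:]"])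
       (simp only: is_unit_const_poly_iff dvd_field_iff, simp)
  then have rep: "reduced_rep f (p, q)"
    by (simp add: reduced_rep_def f_def q_def)
  then obtain e where e: "e \<noteq> 0" "rat_num f = Polynomial.smult e p" "rat_den f = Polynomial.smult e q"
    by (rule reduced_rep_unique)
  have deg: "rat_degree f = 3"
    using e \<open>w \<noteq> 0\<close> by (simp add: rat_degree_def p_def q_def)
  have wronskian_eq: "poly (wronskian p q) x = - 2 * x * (1 - x) * (1 - m * x)" for x
  proof -
    have "poly (wronskian p q) x = - x * (2 * (u * w) * x\<^sup>2 + (u + 3 * w) * x + 2)"
      by (simp add: wronskian_def p_def q_def pderiv_pCons algebra_simps power2_eq_square)
    also have "\<dots> = - 2 * x * (1 - x) * (1 - m * x)"
      unfolding uw u3w by (simp add: algebra_simps power2_eq_square)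
    finally show ?thesis .
  qed
  have "critical_points f \<subseteq> range (map_p1 to_ac)"
  proof
    fix y assume y: "y \<in> critical_points f"
    show "y \<in> range (map_p1 to_ac)"
    proof (cases y)
      case Infty
      then show ?thesis by (metis p1.map(2) rangeI)
    next
      case (Fin x)
      have "poly (wronskian (rat_num f) (rat_den f)) x = 0"
        using y ram_index_gt_1_iff_wronskian[of f x] deg
        by (simp add: critical_points_def Fin del: ram_index.simps)
      then have "poly (wronskian p q) x = 0"
        using e(1) unfolding e(2,3) wronskian_smult by simp
      then have "x = 0 \<or> x = 1 \<or> x = 1 / m"
        using m unfolding wronskian_eq by (auto simp: eq_divide_eq mult.commute)
      then have "x = to_ac 0 \<or> x = to_ac 1 \<or> x = to_ac (1 / \<mu>)"
        by (simp add: m_def)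
      then show ?thesis
        unfolding Fin by (metis p1.map(1) rangeI)
    qed
  qed
  with rational deg obtain g :: "'k poly fract" where g: "rat_equiv f (rat_to_ac g)"
    by blast
  have "f \<noteq> 0"
    by (simp add: f_def p_def q_def Zero_fract_def eq_fract)
  from rep this g obtain c where c: "\<And>i j. plucker p q i j = c * to_ac (plucker (rat_num g) (rat_den g) i j)"
    by (rule plucker_rational_if_rat_equiv) blast
  \<comment> \<open>The ratio of two Plucker coordinates is unchanged by equivalence; for
    \<open>f\<close> this one equals \<open>w\<close>.\<close>
  define v where "v = plucker (rat_num g) (rat_den g) 0 3 / plucker (rat_num g) (rat_den g) 0 2"
  have "plucker p q 0 2 = - 1" "plucker p q 0 3 = - w"
    by (simp_all add: plucker_def p_def q_def eval_nat_numeral)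
  then have "w = plucker p q 0 3 / plucker p q 0 2" "c \<noteq> 0"
    using c[of 0 2] by auto
  then have "w = to_ac v"
    by (simp add: c v_def)
  then have "to_ac ((3 * v + 1 + \<mu>)\<^sup>2) = to_ac (\<mu>\<^sup>2 - \<mu> + 1)"
    using \<open>(3 * w + 1 + m)\<^sup>2 = m\<^sup>2 - m + 1\<close> by (simp add: m_def)
  then show ?thesis
    unfolding to_ac_eq_iff by blast
qed

theorem mainTheorem1:
  shows "(\<forall>f :: 'k::field_char_0 alg_closure poly fract.
            rat_degree f = 3 \<and> critical_points f \<subseteq> range (map_p1 to_ac) \<longrightarrow>
            (\<exists>g :: 'k poly fract. rat_equiv f (rat_to_ac g)))
         \<longleftrightarrow> perfect_wrt (- Fract [:0, 2, 1:] [:3, 2:] :: 'k poly fract)"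
  unfolding perfect_wrt_iff_squares
  using rational_if_squares squares_if_rational by blast

end
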